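(* Let $n\ge1$, $\mathcal N=\{1,\dots,n\}$ and let $q:\mathbb R^n\to\Delta_{n-1}$ be a choice model. The following statements are equivalent: 1. There exists a differentiable choice welfare function $w$ such that $q(\mu)=\nabla w(\mu)$ for all $\mu\in\mathbb R^n$. 2. There exists an essentially strictly convex function $V$ such that for all $\mu\in\mathbb R^n$ $$q(\mu)=\arg\max\{\mu^Tx-V(x)\mid x\in\Delta_{n-1}\}.$$ 3. There exists a set $\Theta$ of distributions of $\epsilon=(\epsilon_1,\dots,\epsilon_n)$ such that for all $\mu\in\mathbb R^n$ $$q(\mu)=\nabla_\mu\Big\{\sup_{\theta\in\Theta}\ \mathbb E_{\epsilon\sim\theta}\Big[\max_{i\in\mathcal N}(\mu_i+\epsilon_i)\Big]\Big\}.$$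
   Context: $\overline{\mathbb R}=\mathbb R\cup\{-\infty,+\infty\}$; $\Delta_{n-1}=\{x\in\mathbb R^n\mid \sum_i x_i=1,\ x\ge0\}$; $\mathbf e$ is the all-ones vector; vector inequalities are componentwise. A choice model is any function $q:\mathbb R^n\to\Delta_{n-1}$ (mapping a utility vector to a choice probability vector). A choice welfare function is a function $w:\mathbb R^n\to\overline{\mathbb R}$ that is monotone ($\mu_1\ge\mu_2\Rightarrow w(\mu_1)\ge w(\mu_2)$), translation invariant ($w(\mu+t\mathbf e)=w(\mu)+t$ for all $\mu\in\mathbb R^n$, $t\in\mathbb R$) and convex ($\lambda w(\mu_1)+(1-\lambda)w(\mu_2)\ge w(\lambda\mu_1+(1-\lambda)\mu_2)$ for $0\le\lambda\le1$). It is a differentiable choice welfare function if it is moreover differentiable on $\mathbb R^n$ (in particular finite-valued). A function $f:X\to\overline{\mathbb R}$ is proper if $f(x)<\infty$ for at least one $x\in X$ and $f(x)>-\infty$ for all $x\in X$. A proper convex function $f$ on $\mathbb R^n$ is essentially strictly convex if it is strictly convex on every convex subset of $\{x\mid\partial f(x)\ne\emptyset\}$, where $\partial f(x)$ is the set of subgradients of $f$ at $x$. A function given only on $\Delta_{n-1}$ is regarded as $+\infty$ outside $\Delta_{n-1}$. Regularization functions $V$ are assumed lower semicontinuous. The equation $q(\mu)=\arg\max\{\cdots\}$ means that the maximizer exists, is unique and equals $q(\mu)$. Distributions in $\Theta$ are probability distributions on $\overline{\mathbb R}^n$ (components may take infinite values) for which the expectation in statement 3 is well defined in $\overline{\mathbb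 R}$; statement 3 includes that the supremum is a finite, differentiable function of $\mu$. *)

theory Defs
  imports "HOL-Probability.Probability"
begin

definition prob_simplex :: "(real^'n) set" where
  "prob_simplex = {x. (\<Sum>i\<in>UNIV. x $ i) = 1 \<and> (\<forall>i. 0 \<le> x $ i)}"

definition choice_model :: "(real^'n \<Rightarrow> real^'n) \<Rightarrow> bool" where
  "choice_model q \<longleftrightarrow> range q \<subseteq> prob_simplex"

(* In type ereal, \<infinity> + (-\<infinity>) = \<infinity> and 0 * \<infinity> = 0. With these conventions the inequality below is
   convexity of the epigraph also for functions that take both infinite values. *)
definition ereal_convex :: "('a::real_vector \<Rightarrow> ereal) \<Rightarrow> bool" where
  "ereal_convex f \<longleftrightarrow> (\<forall>x y. \<forall>u::real. 0 \<le> u \<and> u \<le> 1 \<longrightarrow>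
     f (u *\<^sub>R x + (1 - u) *\<^sub>R y) \<le> ereal u * f x + ereal (1 - u) * f y)"

definition ereal_strictly_convex_on :: "'a::real_vector set \<Rightarrow> ('a \<Rightarrow> ereal) \<Rightarrow> bool" where
  "ereal_strictly_convex_on S f \<longleftrightarrow>
     (\<forall>x\<in>S. \<forall>y\<in>S. \<forall>u::real. x \<noteq> y \<and> 0 < u \<and> u < 1 \<longrightarrow>
        f (u *\<^sub>R x + (1 - u) *\<^sub>R y) < ereal u * f x + ereal (1 - u) * f y)"

(* The order on real^'n is the componentwise one, so mono is monotonicity in that order. *)
definition choice_welfare :: "(real^'n \<Rightarrow> ereal) \<Rightarrow> bool" where
  "choice_welfare w \<longleftrightarrow>
     mono w \<and>
     (\<forall>\<mu>. \<forall>t::real. w (\<mu> + t *\<^sub>R (\<chi> i. 1)) = w \<mu> + ereal t) \<and>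
     ereal_convex w"

(* real_of_ereal maps infinite values to 0, hence the explicit finiteness condition. *)
definition ereal_differentiable :: "('a::real_normed_vector \<Rightarrow> ereal) \<Rightarrow> bool" where
  "ereal_differentiable f \<longleftrightarrow>
     (\<forall>x. \<bar>f x\<bar> \<noteq> \<infinity>) \<and> (\<forall>x. (\<lambda>y. real_of_ereal (f y)) differentiable (at x))"

definition differentiable_choice_welfare :: "(real^'n \<Rightarrow> ereal) \<Rightarrow> bool" where
  "differentiable_choice_welfare w \<longleftrightarrow> choice_welfare w \<and> ereal_differentiable w"

definition proper :: "('a \<Rightarrow> ereal) \<Rightarrow> bool" where
  "proper f \<longleftrightarrow> (\<exists>x. f x < \<infinity>) \<and> (\<forall>x. - \<infinity> < f x)"

definition subgradients :: "('a::real_inner \<Rightarrow> ereal) \<Rightarrow> 'a \<Rightarrow> 'a set" where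
  "subgradients f x = {g. \<forall>y. f x + ereal (g \<bullet> (y - x)) \<le> f y}"

definition essentially_strictly_convex :: "('a::real_inner \<Rightarrow> ereal) \<Rightarrow> bool" where
  "essentially_strictly_convex f \<longleftrightarrow>
     proper f \<and> ereal_convex f \<and>
     (\<forall>S. convex S \<and> S \<subseteq> {x. subgradients f x \<noteq> {}} \<longrightarrow> ereal_strictly_convex_on S f)"

definition lower_semicontinuous :: "('a::topological_space \<Rightarrow> ereal) \<Rightarrow> bool" where
  "lower_semicontinuous f \<longleftrightarrow> (\<forall>x. f x \<le> Liminf (at x) f)"

definition unique_arg_max :: "('a \<Rightarrow> 'b::linorder) \<Rightarrow> 'a set \<Rightarrow> 'a \<Rightarrow> bool" where
  "unique_arg_max f S x \<longleftrightarrow> (\<forall>y. is_arg_max f (\<lambda>z. z \<in> S) y \<longleftrightarrow> y = x)"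

(* e2ennreal truncates negative values to 0, so these are the integrals of the positive and the
   negative part of X; the expectation is well defined unless both are infinite. *)
definition ereal_expectation_defined :: "'a measure \<Rightarrow> ('a \<Rightarrow> ereal) \<Rightarrow> bool" where
  "ereal_expectation_defined M X \<longleftrightarrow>
     X \<in> borel_measurable M \<and>
     ((\<integral>\<^sup>+ \<omega>. e2ennreal (X \<omega>) \<partial>M) < \<infinity> \<or> (\<integral>\<^sup>+ \<omega>. e2ennreal (- X \<omega>) \<partial>M) < \<infinity>)"

definition ereal_expectation :: "'a measure \<Rightarrow> ('a \<Rightarrow> ereal) \<Rightarrow> ereal" where
  "ereal_expectation M X =
     enn2ereal (\<integral>\<^sup>+ \<omega>. e2ennreal (X \<omega>) \<partial>M) - enn2ereal (\<integral>\<^sup>+ \<omega>. e2ennreal (- X \<omega>) \<partial>M)"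

definition max_utility :: "real^'n \<Rightarrow> ereal^'n \<Rightarrow> ereal" where
  "max_utility \<mu> \<epsilon> = (MAX i\<in>UNIV. ereal (\<mu> $ i) + \<epsilon> $ i)"

definition noise_distribution :: "(ereal^'n) measure \<Rightarrow> bool" where
  "noise_distribution \<theta> \<longleftrightarrow>
     prob_space \<theta> \<and> sets \<theta> = sets borel \<and>
     (\<forall>\<mu>. ereal_expectation_defined \<theta> (max_utility \<mu>))"

definition robust_welfare :: "(ereal^'n) measure set \<Rightarrow> real^'n \<Rightarrow> ereal" where
  "robust_welfare \<Theta> \<mu> = (SUP \<theta>\<in>\<Theta>. ereal_expectation \<theta> (max_utility \<mu>))"

end

theory Submission
  imports Defs
begin

text \<open>The three descriptions are linked by Fenchel duality on the simplex.

A differentiable convex function \<open>W\<close> lies above its tangents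
\<open>W \<nu> + q \<nu> \<bullet> (\<mu> - \<nu>)\<close>, where \<open>q \<nu>\<close> is the gradient at \<open>\<nu>\<close>, and hence is their
supremum. Let \<open>V\<close> be the conjugate of \<open>W\<close>, set to \<open>\<infinity>\<close> outside the simplex. Every
maximizer of \<open>\<mu> \<bullet> x - V x\<close> is a subgradient of \<open>W\<close> at \<open>\<mu>\<close>, so it is \<open>q \<mu>\<close>
(\<open>unique_arg_max_simplex_conjugate\<close>). Uniqueness of the maximizers gives essential strict convexity of
\<open>V\<close>: if the strict inequality fails at an interior point of a segment, and \<open>g\<close> is a
subgradient of \<open>V\<close> there, then both end points maximize \<open>g \<bullet> x - V x\<close>
(\<open>unique_arg_max_imp_essentially_strictly_convex\<close>).

Conversely, the optimal value \<open>W \<mu>\<close> of \<open>\<mu> \<bullet> x - V x\<close> is convex with the maximizer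
\<open>q \<mu>\<close> as a subgradient. The simplex is compact and \<open>V\<close> lower semicontinuous, so the unique
maximizer is continuous in \<open>\<mu>\<close>, and a continuous selection of subgradients is a gradient
(\<open>regularized_value_properties\<close>). Monotonicity and translation invariance hold because the
subgradients are probability vectors.

Each tangent of \<open>W\<close> is the expected maximum under a noise distribution that draws one alternative
with probabilities \<open>q \<nu>\<close> and gives \<open>-\<infinity>\<close> to all others, so \<open>W\<close> is a supremum
of expected maxima (\<open>robust_welfare_tangents\<close>). In the other direction the maximum is monotone,
translation invariant and convex in the utilities for each realization of the noise, and these properties
pass to expectations and suprema (\<open>robust_welfare_choice_welfare\<close>).\<close>

section \<open>Tangents of convex functions\<close>

lemma ereal_convex_ereal_iff:
  fixes W :: "'a::real_vector \<Rightarrow> real"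
  shows "ereal_convex (\<lambda>x. ereal (W x)) \<longleftrightarrow> convex_on UNIV W"
  by (simp add: ereal_convex_def convex_on_alt)

lemma convex_GDERIV_imp_above_tangent:
  fixes W :: "'a::real_inner \<Rightarrow> real"
  assumes W: "convex_on UNIV W" and g: "GDERIV W x :> g"
  shows "W x + g \<bullet> (y - x) \<le> W y"
proof -
  define h where "h t = W (x + t *\<^sub>R (y - x))" for t :: real
  have "convex_on UNIV h"
  proof (rule convex_onI)
    fix t a b :: real
    assume t: "t > 0" "t < 1"
    have *: "x + ((1 - t) *\<^sub>R a + t *\<^sub>R b) *\<^sub>R (y - x)
        = (1 - t) *\<^sub>R (x + a *\<^sub>R (y - x)) + t *\<^sub>R (x + b *\<^sub>R (y - x))"
      by (simp add: algebra_simps)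
    show "h ((1 - t) *\<^sub>R a + t *\<^sub>R b) \<le> (1 - t) * h a + t * h b"
      unfolding h_def * using t by (intro convex_onD[OF W]) auto
  qed simp
  moreover have "(h has_field_derivative g \<bullet> (y - x)) (at 0)"
  proof -
    have "((\<lambda>t. x + t *\<^sub>R (y - x)) has_derivative (\<lambda>t. t *\<^sub>R (y - x))) (at 0)"
      by (auto intro!: derivative_eq_intros)
    moreover have "(W has_derivative (\<lambda>h. h \<bullet> g)) (at (x + 0 *\<^sub>R (y - x)))"
      using g by (simp add: gderiv_def)
    ultimately have "(h has_derivative (\<lambda>t. (t *\<^sub>R (y - x)) \<bullet> g)) (at 0)"
      unfolding h_def by (rule has_derivative_compose)
    then show ?thesis
      unfolding has_field_derivative_def
      by (rule has_derivative_eq_rhs) (auto simp: inner_commute mult.commute)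
  qed
  ultimately have "h 1 - h 0 \<ge> g \<bullet> (y - x) * (1 - 0)"
    by (intro convex_on_imp_above_tangent[of UNIV]) auto
  then show ?thesis by (simp add: h_def)
qed

text \<open>The point \<open>x\<close> minimizes \<open>W y - y \<bullet> z\<close>.\<close>

lemma GDERIV_subgradient_unique:
  fixes W :: "'a::real_inner \<Rightarrow> real"
  assumes g: "GDERIV W x :> g" and le: "\<And>y. W x + z \<bullet> (y - x) \<le> W y"
  shows "z = g"
proof -
  have "((\<lambda>y. W y - y \<bullet> z) has_derivative (\<lambda>h. h \<bullet> g - h \<bullet> z)) (at x)"
    using g unfolding gderiv_def by (auto intro!: derivative_eq_intros)
  moreover have "\<forall>\<^sub>F y in at x. W x - x \<bullet> z \<le> W y - y \<bullet> z"
    using le by (intro always_eventually allI) (simp add: inner_diff_right inner_commute algebra_simps)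
  ultimately have "(\<lambda>h. h \<bullet> g - h \<bullet> z) = (\<lambda>h. 0)"
    by (rule has_derivative_local_min)
  then have "(g - z) \<bullet> g - (g - z) \<bullet> z = 0"
    by (rule fun_cong)
  then have "(g - z) \<bullet> (g - z) = 0"
    by (simp add: inner_diff_right)
  then show ?thesis by simp
qed

lemma GDERIV_of_continuous_subgradient:
  fixes W :: "'a::real_inner \<Rightarrow> real"
  assumes le: "\<And>x y. W x + q x \<bullet> (y - x) \<le> W y" and q: "isCont q x"
  shows "GDERIV W x :> q x"
  unfolding gderiv_def has_derivative_at_alt
proof (intro conjI allI impI)
  show "bounded_linear (\<lambda>h. h \<bullet> q x)"
    by (rule bounded_linear_inner_left)
next
  fix e :: real
  assume "e > 0"
  then obtain d where d: "d > 0" "\<And>y. dist y x < d \<Longrightarrow> dist (q y) (q x) < e"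
    using q unfolding continuous_at_eps_delta by blast
  show "\<exists>d>0. \<forall>y. norm (y - x) < d \<longrightarrow> norm (W y - W x - (y - x) \<bullet> q x) \<le> e * norm (y - x)"
  proof (intro exI[of _ d] conjI allI impI)
    fix y
    assume y: "norm (y - x) < d"
    have "0 \<le> W y - W x - (y - x) \<bullet> q x"
      using le[of x y] by (simp add: inner_commute)
    moreover have "W y - W x - (y - x) \<bullet> q x \<le> (q y - q x) \<bullet> (y - x)"
      using le[of y x] by (simp add: inner_diff_left inner_diff_right inner_commute algebra_simps)
    moreover have "(q y - q x) \<bullet> (y - x) \<le> norm (q y - q x) * norm (y - x)"
      by (rule norm_cauchy_schwarz)
    moreover have "norm (q y - q x) * norm (y - x) \<le> e * norm (y - x)"
      using d(2)[of y] y by (intro mult_right_mono) (auto simp: dist_norm)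
    ultimately show "norm (W y - W x - (y - x) \<bullet> q x) \<le> e * norm (y - x)"
      by simp
  qed (rule d(1))
qed

section \<open>Regularized maximization\<close>

lemma unique_arg_max_iff:
  "unique_arg_max f S x \<longleftrightarrow> x \<in> S \<and> (\<forall>y\<in>S. f y \<le> f x) \<and> (\<forall>y\<in>S. f x \<le> f y \<longrightarrow> y = x)"
proof
  assume u: "unique_arg_max f S x"
  then have "is_arg_max f (\<lambda>z. z \<in> S) x"
    by (simp add: unique_arg_max_def)
  then have x: "x \<in> S" "\<And>y. y \<in> S \<Longrightarrow> f y \<le> f x"
    by (auto simp: is_arg_max_def not_less)
  have "y = x" if "y \<in> S" "f x \<le> f y" for y
  proof -
    have "is_arg_max f (\<lambda>z. z \<in> S) y"
      using that x(2) by (auto simp: is_arg_max_def not_less intro: order_trans)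
    then show ?thesis using u by (simp add: unique_arg_max_def)
  qed
  with x show "x \<in> S \<and> (\<forall>y\<in>S. f y \<le> f x) \<and> (\<forall>y\<in>S. f x \<le> f y \<longrightarrow> y = x)"
    by blast
next
  assume *: "x \<in> S \<and> (\<forall>y\<in>S. f y \<le> f x) \<and> (\<forall>y\<in>S. f x \<le> f y \<longrightarrow> y = x)"
  show "unique_arg_max f S x"
    unfolding unique_arg_max_def is_arg_max_def not_less[symmetric]
    using * by (auto simp: not_less)
qed

lemma subgradient_imp_finite:
  assumes "proper V" "subgradients V x \<noteq> {}"
  shows "\<bar>V x\<bar> \<noteq> \<infinity>"
proof -
  obtain y where y: "V y < \<infinity>" using assms(1) by (auto simp: proper_def)
  obtain g where "V x + ereal (g \<bullet> (y - x)) \<le> V y"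
    using assms(2) by (auto simp: subgradients_def)
  with y have "V x \<noteq> \<infinity>" by auto
  moreover have "V x \<noteq> - \<infinity>" using assms(1) by (auto simp: proper_def)
  ultimately show ?thesis by auto
qed

lemma unique_arg_max_imp_essentially_strictly_convex:
  fixes V :: "'a::real_inner \<Rightarrow> ereal"
  assumes "proper V" "ereal_convex V" and outside: "\<And>x. x \<notin> D \<Longrightarrow> V x = \<infinity>"
    and umax: "\<And>\<mu>. unique_arg_max (\<lambda>x. ereal (\<mu> \<bullet> x) - V x) D (q \<mu>)"
  shows "essentially_strictly_convex V"
  unfolding essentially_strictly_convex_def
proof (intro conjI allI impI)
  fix S
  assume "convex S \<and> S \<subseteq> {x. subgradients V x \<noteq> {}}"
  then have S: "convex S" "\<And>x. x \<in> S \<Longrightarrow> subgradients V x \<noteq> {}"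
    by auto
  show "ereal_strictly_convex_on S V"
    unfolding ereal_strictly_convex_on_def
  proof (intro ballI allI impI)
    fix x y and u :: real
    assume xy: "x \<in> S" "y \<in> S" and u: "x \<noteq> y \<and> 0 < u \<and> u < 1"
    define z where "z = u *\<^sub>R x + (1 - u) *\<^sub>R y"
    have z: "z \<in> S"
      using convexD[OF S(1) xy, of u "1 - u"] u by (simp add: z_def)
    obtain g where g: "\<And>y. V z + ereal (g \<bullet> (y - z)) \<le> V y"
      using S(2)[OF z] by (auto simp: subgradients_def)
    have fin: "\<exists>r. V v = ereal r" if "v \<in> S" for v
      using subgradient_imp_finite[OF \<open>proper V\<close> S(2)[OF that]] by (cases "V v") auto
    obtain a b c where abc: "V x = ereal a" "V y = ereal b" "V z = ereal c"
      using fin xy z by metis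
    have D: "x \<in> D" "y \<in> D" "z \<in> D"
      using abc outside by (metis PInfty_neq_ereal(1))+
    have gx: "c + g \<bullet> (x - z) \<le> a" and gy: "c + g \<bullet> (y - z) \<le> b"
      using g[of x] g[of y] abc by simp_all
    have sum0: "u * (g \<bullet> (x - z)) + (1 - u) * (g \<bullet> (y - z)) = 0"
      by (simp add: z_def inner_diff_right inner_add_right algebra_simps)
    have "c < u * a + (1 - u) * b"
    proof (rule ccontr)
      assume "\<not> c < u * a + (1 - u) * b"
      then have le: "u * (a - c - g \<bullet> (x - z)) + (1 - u) * (b - c - g \<bullet> (y - z)) \<le> 0"
        using sum0 by (simp add: algebra_simps)
      have "0 \<le> u * (a - c - g \<bullet> (x - z))" "0 \<le> (1 - u) * (b - c - g \<bullet> (y - z))"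
        using gx gy u by auto
      with le have "u * (a - c - g \<bullet> (x - z)) = 0" "(1 - u) * (b - c - g \<bullet> (y - z)) = 0"
        by linarith+
      then have eq: "a = c + g \<bullet> (x - z)" "b = c + g \<bullet> (y - z)"
        using u by auto
      \<comment> \<open>Equality makes both end points maximizers for the subgradient as utility vector.\<close>
      have max: "v = q g" if "v \<in> D" "ereal (g \<bullet> v) - V v = ereal (g \<bullet> z - c)" for v
      proof -
        have "ereal (g \<bullet> q g) - V (q g) \<le> ereal (g \<bullet> z - c)"
          using g[of "q g"] abc(3) by (cases "V (q g)") (auto simp: inner_diff_right)
        then show ?thesis
          using umax[of g] that unfolding unique_arg_max_iff by metis
      qed
      have "x = q g" by (rule max) (use D abc eq in \<open>auto simp: inner_diff_right\<close>)
      moreover have "y = q g" by (rule max) (use D abc eq in \<open>auto simp: inner_diff_right\<close>)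
      ultimately show False using u by simp
    qed
    then show "V (u *\<^sub>R x + (1 - u) *\<^sub>R y) < ereal u * V x + ereal (1 - u) * V y"
      unfolding z_def[symmetric] abc by simp
  qed
qed (use assms in auto)

lemma closed_prob_simplex: "closed (prob_simplex :: (real^'n) set)"
  unfolding prob_simplex_def Collect_conj_eq
  by (intro closed_Int closed_Collect_eq closed_Collect_all closed_Collect_le continuous_intros)

lemma compact_prob_simplex: "compact (prob_simplex :: (real^'n) set)"
  unfolding compact_eq_bounded_closed
proof
  show "bounded (prob_simplex :: (real^'n) set)"
  proof (rule boundedI)
    fix x :: "real^'n"
    assume "x \<in> prob_simplex"
    then have "(\<Sum>i\<in>UNIV. \<bar>x $ i\<bar>) = 1"
      by (simp add: prob_simplex_def)
    with norm_le_l1_cart[of x] show "norm x \<le> 1" by simp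
  qed
qed (rule closed_prob_simplex)

lemma convex_prob_simplex: "convex (prob_simplex :: (real^'n) set)"
  unfolding convex_def prob_simplex_def
  by (auto simp: sum.distrib sum_distrib_left[symmetric])

text \<open>The convex conjugate of a real function on the simplex, extended by \<open>\<infinity>\<close>.\<close>

definition simplex_conjugate :: "(real^'n \<Rightarrow> real) \<Rightarrow> real^'n \<Rightarrow> ereal" where
  "simplex_conjugate W x = (if x \<in> prob_simplex then SUP \<mu>. ereal (\<mu> \<bullet> x - W \<mu>) else \<infinity>)"

lemma simplex_conjugate_ge: "ereal (\<mu> \<bullet> x - W \<mu>) \<le> simplex_conjugate W x"
  unfolding simplex_conjugate_def by (auto intro: SUP_upper)

lemma simplex_conjugate_convex:
  fixes W :: "real^'n \<Rightarrow> real"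
  shows "ereal_convex (simplex_conjugate W)"
  unfolding ereal_convex_def
proof (intro allI impI)
  fix x y :: "real^'n" and u :: real
  assume u: "0 \<le> u \<and> u \<le> 1"
  let ?V = "simplex_conjugate W"
  show "?V (u *\<^sub>R x + (1 - u) *\<^sub>R y) \<le> ereal u * ?V x + ereal (1 - u) * ?V y"
  proof (cases "u = 0 \<or> u = 1")
    case True
    \<comment> \<open>The point with coefficient \<open>0\<close> contributes nothing, since \<open>0 * \<infinity> = 0\<close>.\<close>
    then show ?thesis by (auto simp: zero_ereal_def[symmetric])
  next
    case False
    with u have u: "0 < u" "u < 1" by auto
    show ?thesis
    proof (cases "x \<in> prob_simplex \<and> y \<in> prob_simplex")
      case False
      then have "?V x = \<infinity> \<or> ?V y = \<infinity>" by (auto simp: simplex_conjugate_def)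
      then show ?thesis using u by auto
    next
      case True
      then have "u *\<^sub>R x + (1 - u) *\<^sub>R y \<in> prob_simplex"
        using u by (intro convexD[OF convex_prob_simplex]) auto
      then have "?V (u *\<^sub>R x + (1 - u) *\<^sub>R y)
          = (SUP \<mu>. ereal (\<mu> \<bullet> (u *\<^sub>R x + (1 - u) *\<^sub>R y) - W \<mu>))"
        by (simp add: simplex_conjugate_def)
      also have "\<dots> \<le> ereal u * ?V x + ereal (1 - u) * ?V y"
      proof (rule SUP_least)
        fix \<mu> :: "real^'n"
        have "ereal (\<mu> \<bullet> (u *\<^sub>R x + (1 - u) *\<^sub>R y) - W \<mu>)
            = ereal u * ereal (\<mu> \<bullet> x - W \<mu>) + ereal (1 - u) * ereal (\<mu> \<bullet> y - W \<mu>)"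
          by (simp add: inner_add_right algebra_simps)
        also have "\<dots> \<le> ereal u * ?V x + ereal (1 - u) * ?V y"
          using u by (intro add_mono ereal_mult_left_mono simplex_conjugate_ge) auto
        finally show "ereal (\<mu> \<bullet> (u *\<^sub>R x + (1 - u) *\<^sub>R y) - W \<mu>)
            \<le> ereal u * ?V x + ereal (1 - u) * ?V y" .
      qed
      finally show ?thesis .
    qed
  qed
qed

lemma simplex_conjugate_lower_semicontinuous:
  fixes W :: "real^'n \<Rightarrow> real"
  shows "lower_semicontinuous (simplex_conjugate W)"
  unfolding lower_semicontinuous_def le_Liminf_iff
proof (intro allI impI)
  fix x :: "real^'n" and c
  assume c: "c < simplex_conjugate W x"
  show "\<forall>\<^sub>F y in at x. c < simplex_conjugate W y"
  proof (cases "x \<in> prob_simplex")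
    case True
    with c obtain \<mu> where \<mu>: "c < ereal (\<mu> \<bullet> x - W \<mu>)"
      by (auto simp: simplex_conjugate_def less_SUP_iff)
    have "((\<lambda>y. ereal (\<mu> \<bullet> y - W \<mu>)) \<longlongrightarrow> ereal (\<mu> \<bullet> x - W \<mu>)) (at x)"
      by (intro tendsto_intros)
    then have "\<forall>\<^sub>F y in at x. c < ereal (\<mu> \<bullet> y - W \<mu>)"
      using \<mu> by (rule order_tendstoD)
    then show ?thesis
      by eventually_elim (use simplex_conjugate_ge less_le_trans in blast)
  next
    case False
    then have "\<forall>\<^sub>F y in nhds x. y \<in> - prob_simplex"
      using closed_prob_simplex by (intro eventually_nhds_in_open) (auto simp: open_Compl)
    then have "\<forall>\<^sub>F y in at x. y \<in> - prob_simplex"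
      by (simp add: eventually_at_filter eventually_mono)
    then show ?thesis
      by eventually_elim (use c False in \<open>auto simp: simplex_conjugate_def\<close>)
  qed
qed

text \<open>For a differentiable convex function the Fenchel equality at the gradient holds, and it holds
  nowhere else because a differentiable function has no other subgradient.\<close>

lemma unique_arg_max_simplex_conjugate:
  fixes W :: "real^'n \<Rightarrow> real"
  assumes W: "convex_on UNIV W" and g: "\<And>\<mu>. GDERIV W \<mu> :> q \<mu>" and q: "\<And>\<mu>. q \<mu> \<in> prob_simplex"
  shows "unique_arg_max (\<lambda>x. ereal (\<mu> \<bullet> x) - simplex_conjugate W x) prob_simplex (q \<mu>)"
    and "simplex_conjugate W (q \<mu>) = ereal (\<mu> \<bullet> q \<mu> - W \<mu>)"
proof -
  show V: "simplex_conjugate W (q \<mu>) = ereal (\<mu> \<bullet> q \<mu> - W \<mu>)"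
  proof (rule antisym)
    show "simplex_conjugate W (q \<mu>) \<le> ereal (\<mu> \<bullet> q \<mu> - W \<mu>)"
      unfolding simplex_conjugate_def
      using q convex_GDERIV_imp_above_tangent[OF W g, of \<mu>]
      by (auto intro!: SUP_least simp: inner_diff_right inner_commute algebra_simps)
  qed (rule simplex_conjugate_ge)
  show "unique_arg_max (\<lambda>x. ereal (\<mu> \<bullet> x) - simplex_conjugate W x) prob_simplex (q \<mu>)"
    unfolding unique_arg_max_iff
  proof (intro conjI ballI impI q)
    fix x :: "real^'n"
    show "ereal (\<mu> \<bullet> x) - simplex_conjugate W x \<le> ereal (\<mu> \<bullet> q \<mu>) - simplex_conjugate W (q \<mu>)"
      unfolding V using simplex_conjugate_ge[of \<mu> x W] by (cases "simplex_conjugate W x") auto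
    assume "ereal (\<mu> \<bullet> q \<mu>) - simplex_conjugate W (q \<mu>) \<le> ereal (\<mu> \<bullet> x) - simplex_conjugate W x"
    then have x: "simplex_conjugate W x \<le> ereal (\<mu> \<bullet> x - W \<mu>)"
      unfolding V by (cases "simplex_conjugate W x") auto
    have "W \<mu> + x \<bullet> (\<nu> - \<mu>) \<le> W \<nu>" for \<nu>
      using order_trans[OF simplex_conjugate_ge[of \<nu> x W] x]
      by (simp add: inner_diff_right inner_commute algebra_simps)
    then show "x = q \<mu>" by (rule GDERIV_subgradient_unique[OF g])
  qed
qed

section \<open>The optimal value of the regularized problem\<close>

text \<open>The optimal value is a supremum of affine functions with the maximizers as subgradients. The
  maximizer depends continuously on the utilities: its graph is closed by lower semicontinuity, and it
  takes values in a compact set. Hence the value is differentiable.\<close>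

lemma regularized_value_properties:
  fixes V :: "real^'n \<Rightarrow> ereal"
  assumes V: "proper V" "lower_semicontinuous V" and outside: "\<And>x. x \<notin> prob_simplex \<Longrightarrow> V x = \<infinity>"
    and umax: "\<And>\<mu>. unique_arg_max (\<lambda>x. ereal (\<mu> \<bullet> x) - V x) prob_simplex (q \<mu>)"
  obtains W where "\<And>\<mu> x. ereal (\<mu> \<bullet> x) - V x \<le> ereal (W \<mu>)"
    "\<And>\<mu>. ereal (\<mu> \<bullet> q \<mu>) - V (q \<mu>) = ereal (W \<mu>)"
    "convex_on UNIV W" "\<And>\<mu>. GDERIV W \<mu> :> q \<mu>"
proof -
  have q: "q \<mu> \<in> prob_simplex" for \<mu>
    using umax by (auto simp: unique_arg_max_iff)
  have V_gt: "V x \<noteq> - \<infinity>" for x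
    using V(1) by (auto simp: proper_def)
  obtain x0 where x0: "V x0 < \<infinity>" using V(1) by (auto simp: proper_def)
  then have x0': "x0 \<in> prob_simplex" using outside[of x0] by auto
  have Vq: "\<bar>V (q \<mu>)\<bar> \<noteq> \<infinity>" for \<mu>
  proof -
    have "ereal (\<mu> \<bullet> x0) - V x0 \<le> ereal (\<mu> \<bullet> q \<mu>) - V (q \<mu>)"
      using umax[of \<mu>] x0' by (auto simp: unique_arg_max_iff)
    then show ?thesis
      using x0 V_gt[of x0] V_gt[of "q \<mu>"] by (cases "V (q \<mu>)"; cases "V x0") auto
  qed
  define W where "W \<mu> = \<mu> \<bullet> q \<mu> - real_of_ereal (V (q \<mu>))" for \<mu>
  have Vq': "V (q \<mu>) = ereal (\<mu> \<bullet> q \<mu> - W \<mu>)" for \<mu>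
    using Vq[of \<mu>] by (simp add: W_def ereal_real)
  have W_eq: "ereal (\<mu> \<bullet> q \<mu>) - V (q \<mu>) = ereal (W \<mu>)" for \<mu>
    by (simp add: Vq')
  have W_ge: "ereal (\<mu> \<bullet> x) - V x \<le> ereal (W \<mu>)" for \<mu> x
  proof (cases "x \<in> prob_simplex")
    case True
    then show ?thesis
      using umax[of \<mu>] by (auto simp: unique_arg_max_iff W_eq[symmetric])
  qed (simp add: outside)
  have sub: "W \<mu> + q \<mu> \<bullet> (\<nu> - \<mu>) \<le> W \<nu>" for \<mu> \<nu>
    using W_ge[of \<nu> "q \<mu>"] by (simp add: Vq' inner_diff_right inner_commute algebra_simps)
  have conv: "convex_on UNIV W"
  proof (rule convex_onI)
    fix t :: real and x y :: "real^'n"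
    assume t: "0 < t" "t < 1"
    define z where "z = (1 - t) *\<^sub>R x + t *\<^sub>R y"
    have "(1 - t) * (W z + q z \<bullet> (x - z)) + t * (W z + q z \<bullet> (y - z)) \<le> (1 - t) * W x + t * W y"
      using t sub by (intro add_mono mult_left_mono) auto
    moreover have "(1 - t) * (W z + q z \<bullet> (x - z)) + t * (W z + q z \<bullet> (y - z)) = W z + q z \<bullet> (z - z)"
      by (subst (6) z_def) (simp add: inner_diff_right inner_add_right algebra_simps)
    ultimately show "W ((1 - t) *\<^sub>R x + t *\<^sub>R y) \<le> (1 - t) * W x + t * W y"
      by (simp add: z_def)
  qed simp
  have contW: "continuous_on UNIV W"
    by (rule convex_on_continuous[OF open_UNIV conv])
  have "open {p. ereal (fst p \<bullet> snd p - W (fst p)) < V (snd p)}" (is "open ?S")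
  proof (subst open_subopen, intro ballI)
    fix p
    assume "p \<in> ?S"
    then obtain c where c: "ereal (fst p \<bullet> snd p - W (fst p)) < c" "c < V (snd p)"
      using dense by blast
    have "\<forall>\<^sub>F y in at (snd p). c < V y"
      using V(2) c(2) by (auto simp: lower_semicontinuous_def le_Liminf_iff)
    then have "\<forall>\<^sub>F y in nhds (snd p). c < V y"
      using c(2) by (simp add: eventually_nhds_conv_at)
    then obtain B where B: "open B" "snd p \<in> B" "\<And>y. y \<in> B \<Longrightarrow> c < V y"
      by (auto simp: eventually_nhds)
    have "continuous_on UNIV (\<lambda>p. fst p \<bullet> snd p - W (fst p))"
      by (intro continuous_intros continuous_on_compose2[OF contW]) auto
    then have "open {p. ereal (fst p \<bullet> snd p - W (fst p)) < c}"
      by (intro open_Collect_less continuous_on_ereal) auto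
    then have "open ({p. ereal (fst p \<bullet> snd p - W (fst p)) < c} \<inter> (UNIV \<times> B))"
      using B(1) by (intro open_Int open_Times) auto
    then show "\<exists>T. open T \<and> p \<in> T \<and> T \<subseteq> ?S"
      using B c by (intro exI conjI) (auto simp: mem_Times_iff intro: less_trans)
  qed
  then have "closed {p. V (snd p) \<le> ereal (fst p \<bullet> snd p - W (fst p))}"
    by (simp add: closed_def Collect_neg_eq[symmetric] not_le)
  moreover have "{p. V (snd p) \<le> ereal (fst p \<bullet> snd p - W (fst p))} = (\<lambda>\<mu>. (\<mu>, q \<mu>)) ` UNIV"
  proof -
    have "x = q \<mu>" if "V x \<le> ereal (\<mu> \<bullet> x - W \<mu>)" for x \<mu>
    proof -
      have "x \<in> prob_simplex"
        using that outside[of x] by (cases "x \<in> prob_simplex") auto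
      moreover have "ereal (\<mu> \<bullet> q \<mu>) - V (q \<mu>) \<le> ereal (\<mu> \<bullet> x) - V x"
        unfolding W_eq using that V_gt[of x] by (cases "V x") auto
      ultimately show ?thesis
        using umax[of \<mu>] by (auto simp: unique_arg_max_iff)
    qed
    then show ?thesis by (auto simp: Vq')
  qed
  ultimately have "closed ((\<lambda>\<mu>. (\<mu>, q \<mu>)) ` UNIV)" by simp
  then have "continuous_on UNIV q"
    using q by (intro continuous_from_closed_graph[OF compact_prob_simplex]) (auto intro: closed_subset)
  then have "GDERIV W \<mu> :> q \<mu>" for \<mu>
    using sub by (intro GDERIV_of_continuous_subgradient) (auto simp: continuous_on_eq_continuous_at)
  with W_ge W_eq conv show thesis by (rule that)
qed

text \<open>The probability vector \<open>q \<mu>\<close> is a subgradient of \<open>W\<close> at \<open>\<mu>\<close>; it is nonnegative,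
  which gives monotonicity, and has sum one, which gives translation invariance.\<close>

lemma choice_welfare_of_simplex_sup:
  fixes V :: "real^'n \<Rightarrow> ereal" and W :: "real^'n \<Rightarrow> real"
  assumes q: "\<And>\<mu>. q \<mu> \<in> prob_simplex" and V: "\<And>\<mu>. V (q \<mu>) = ereal (\<mu> \<bullet> q \<mu> - W \<mu>)"
    and ge: "\<And>\<mu> x. ereal (\<mu> \<bullet> x) - V x \<le> ereal (W \<mu>)" and conv: "convex_on UNIV W"
  shows "choice_welfare (\<lambda>\<mu>. ereal (W \<mu>))"
proof -
  have sub: "W \<mu> + q \<mu> \<bullet> (\<nu> - \<mu>) \<le> W \<nu>" for \<mu> \<nu>
    using ge[of \<nu> "q \<mu>"] by (simp add: V inner_diff_right inner_commute algebra_simps)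
  have "W \<mu> \<le> W \<nu>" if "\<mu> \<le> \<nu>" for \<mu> \<nu>
  proof -
    have "0 \<le> q \<mu> \<bullet> (\<nu> - \<mu>)"
      using q[of \<mu>] that by (auto simp: inner_vec_def prob_simplex_def less_eq_vec_def intro!: sum_nonneg)
    with sub[of \<mu> \<nu>] show ?thesis by simp
  qed
  then have mono: "mono (\<lambda>\<mu>. ereal (W \<mu>))"
    by (auto intro: monoI)
  have q1: "q \<mu> \<bullet> (\<chi> i. 1) = 1" for \<mu>
    using q[of \<mu>] by (simp add: inner_vec_def prob_simplex_def)
  have trans: "W (\<mu> + t *\<^sub>R (\<chi> i. 1)) = W \<mu> + t" for \<mu> t
    using sub[of \<mu> "\<mu> + t *\<^sub>R (\<chi> i. 1)"] sub[of "\<mu> + t *\<^sub>R (\<chi> i. 1)" \<mu>] q1 by simp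
  show ?thesis
    using mono trans conv by (simp add: choice_welfare_def ereal_convex_ereal_iff)
qed

section \<open>Expected maxima\<close>

lemma nn_integral_parts_of_integrable:
  assumes Y: "integrable M Y" and X: "AE \<omega> in M. X \<omega> = ereal (Y \<omega>)"
  shows "(\<integral>\<^sup>+ \<omega>. e2ennreal (X \<omega>) \<partial>M) = (\<integral>\<^sup>+ \<omega>. ennreal (Y \<omega>) \<partial>M)" (is ?pos)
    and "(\<integral>\<^sup>+ \<omega>. e2ennreal (- X \<omega>) \<partial>M) = (\<integral>\<^sup>+ \<omega>. ennreal (- Y \<omega>) \<partial>M)" (is ?neg)
    and "(\<integral>\<^sup>+ \<omega>. ennreal (Y \<omega>) \<partial>M) < \<infinity>" "(\<integral>\<^sup>+ \<omega>. ennreal (- Y \<omega>) \<partial>M) < \<infinity>"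
proof -
  show ?pos ?neg
    by (intro nn_integral_cong_AE, use X in eventually_elim, simp)+
qed (use Y in \<open>auto simp: real_integrable_def top.not_eq_extremum\<close>)

lemma ereal_expectation_eq_integral:
  assumes Y: "integrable M Y" and X: "AE \<omega> in M. X \<omega> = ereal (Y \<omega>)"
  shows "ereal_expectation M X = ereal (integral\<^sup>L M Y)"
proof -
  note parts = nn_integral_parts_of_integrable[OF assms]
  obtain a b where ab: "(\<integral>\<^sup>+ \<omega>. ennreal (Y \<omega>) \<partial>M) = ennreal a" "0 \<le> a"
      "(\<integral>\<^sup>+ \<omega>. ennreal (- Y \<omega>) \<partial>M) = ennreal b" "0 \<le> b"
    using parts(3,4) by (metis ennreal_cases infinity_ennreal_def less_irrefl)
  then show ?thesis
    unfolding ereal_expectation_def parts(1,2) real_lebesgue_integral_def[OF Y] by simp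
qed

lemma integrable_of_ereal_expectation:
  assumes def: "ereal_expectation_defined M X" and fin: "\<bar>ereal_expectation M X\<bar> \<noteq> \<infinity>"
  shows "integrable M (\<lambda>\<omega>. real_of_ereal (X \<omega>))"
    and "AE \<omega> in M. X \<omega> = ereal (real_of_ereal (X \<omega>))"
    and "ereal_expectation M X = ereal (integral\<^sup>L M (\<lambda>\<omega>. real_of_ereal (X \<omega>)))"
proof -
  have [measurable]: "X \<in> borel_measurable M"
    using def by (simp add: ereal_expectation_defined_def)
  have pos: "(\<integral>\<^sup>+ \<omega>. e2ennreal (X \<omega>) \<partial>M) \<noteq> \<infinity>" and neg: "(\<integral>\<^sup>+ \<omega>. e2ennreal (- X \<omega>) \<partial>M) \<noteq> \<infinity>"
    using def fin unfolding ereal_expectation_defined_def ereal_expectation_def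
    by (cases "\<integral>\<^sup>+ \<omega>. e2ennreal (X \<omega>) \<partial>M"; cases "\<integral>\<^sup>+ \<omega>. e2ennreal (- X \<omega>) \<partial>M"; simp)+
  have "AE \<omega> in M. e2ennreal (X \<omega>) \<noteq> \<infinity>" "AE \<omega> in M. e2ennreal (- X \<omega>) \<noteq> \<infinity>"
    using pos neg by (intro nn_integral_PInf_AE; simp)+
  then show ae: "AE \<omega> in M. X \<omega> = ereal (real_of_ereal (X \<omega>))"
  proof eventually_elim
    case (elim \<omega>)
    then show ?case by (cases "X \<omega>") auto
  qed
  have "(\<integral>\<^sup>+ \<omega>. ennreal (real_of_ereal (X \<omega>)) \<partial>M) = (\<integral>\<^sup>+ \<omega>. e2ennreal (X \<omega>) \<partial>M)"
    by (intro nn_integral_cong_AE, use ae in eventually_elim) (metis e2ennreal_ereal)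
  moreover have "(\<integral>\<^sup>+ \<omega>. ennreal (- real_of_ereal (X \<omega>)) \<partial>M) = (\<integral>\<^sup>+ \<omega>. e2ennreal (- X \<omega>) \<partial>M)"
    by (intro nn_integral_cong_AE, use ae in eventually_elim) (metis e2ennreal_ereal uminus_ereal.simps(1))
  ultimately show int: "integrable M (\<lambda>\<omega>. real_of_ereal (X \<omega>))"
    using pos neg by (auto simp: real_integrable_def)
  show "ereal_expectation M X = ereal (integral\<^sup>L M (\<lambda>\<omega>. real_of_ereal (X \<omega>)))"
    by (rule ereal_expectation_eq_integral[OF int ae])
qed

lemma ereal_expectation_mono:
  assumes "\<And>\<omega>. X \<omega> \<le> Y \<omega>"
  shows "ereal_expectation M X \<le> ereal_expectation M Y"
  unfolding ereal_expectation_def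
  using assms
  by (intro ereal_minus_mono less_eq_ennreal.rep_eq[THEN iffD1] nn_integral_mono e2ennreal_mono) simp_all

lemma max_utility_ge: "ereal (\<mu> $ i) + \<epsilon> $ i \<le> max_utility \<mu> \<epsilon>"
  unfolding max_utility_def by (rule Max_ge) auto

lemma max_utility_leI: "(\<And>i. ereal (\<mu> $ i) + \<epsilon> $ i \<le> c) \<Longrightarrow> max_utility \<mu> \<epsilon> \<le> c"
  unfolding max_utility_def by (subst Max_le_iff) auto

lemma max_utility_mono: "\<mu> \<le> \<nu> \<Longrightarrow> max_utility \<mu> \<epsilon> \<le> max_utility \<nu> \<epsilon>"
  by (rule max_utility_leI, rule order_trans[OF _ max_utility_ge])
    (auto simp: less_eq_vec_def intro!: add_right_mono)

lemma max_utility_translate: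
  "max_utility (\<mu> + t *\<^sub>R (\<chi> i. 1)) \<epsilon> = max_utility \<mu> \<epsilon> + ereal t"
proof -
  have le: "max_utility (\<mu> + t *\<^sub>R (\<chi> i. 1)) \<epsilon> \<le> max_utility \<mu> \<epsilon> + ereal t" for \<mu> :: "real^'a" and t
  proof (rule max_utility_leI)
    fix i
    have "ereal ((\<mu> + t *\<^sub>R (\<chi> i. 1)) $ i) + \<epsilon> $ i = (ereal (\<mu> $ i) + \<epsilon> $ i) + ereal t"
      by (cases "\<epsilon> $ i") auto
    then show "ereal ((\<mu> + t *\<^sub>R (\<chi> i. 1)) $ i) + \<epsilon> $ i \<le> max_utility \<mu> \<epsilon> + ereal t"
      by (simp add: add_right_mono max_utility_ge)
  qed
  have "max_utility \<mu> \<epsilon> \<le> max_utility (\<mu> + t *\<^sub>R (\<chi> i. 1)) \<epsilon> + ereal (- t)"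
    using le[of "\<mu> + t *\<^sub>R (\<chi> i. 1)" "- t"] by simp
  then have "max_utility \<mu> \<epsilon> + ereal t \<le> max_utility (\<mu> + t *\<^sub>R (\<chi> i. 1)) \<epsilon>"
    by (cases "max_utility \<mu> \<epsilon>"; cases "max_utility (\<mu> + t *\<^sub>R (\<chi> i. 1)) \<epsilon>") auto
  with le show ?thesis by (rule antisym)
qed

lemma max_utility_convex:
  assumes "0 < u" "u < 1"
  shows "max_utility (u *\<^sub>R \<mu> + (1 - u) *\<^sub>R \<nu>) \<epsilon>
    \<le> ereal u * max_utility \<mu> \<epsilon> + ereal (1 - u) * max_utility \<nu> \<epsilon>"
proof (rule max_utility_leI)
  fix i
  have "ereal ((u *\<^sub>R \<mu> + (1 - u) *\<^sub>R \<nu>) $ i) + \<epsilon> $ i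
      = ereal u * (ereal (\<mu> $ i) + \<epsilon> $ i) + ereal (1 - u) * (ereal (\<nu> $ i) + \<epsilon> $ i)"
    using assms by (cases "\<epsilon> $ i") (auto simp: algebra_simps)
  also have "\<dots> \<le> ereal u * max_utility \<mu> \<epsilon> + ereal (1 - u) * max_utility \<nu> \<epsilon>"
    using assms by (intro add_mono ereal_mult_left_mono max_utility_ge) auto
  finally show "ereal ((u *\<^sub>R \<mu> + (1 - u) *\<^sub>R \<nu>) $ i) + \<epsilon> $ i
    \<le> ereal u * max_utility \<mu> \<epsilon> + ereal (1 - u) * max_utility \<nu> \<epsilon>" .
qed

text \<open>The maximum may take infinite values, and its expectation may be \<open>-\<infinity>\<close>. If no
  expectation is \<open>\<infinity>\<close>, then the value \<open>-\<infinity>\<close> occurs for all utility vectors or for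
  none; in the second case the maxima are almost surely finite with real integrals.\<close>

lemma expected_max_translate:
  assumes noise: "noise_distribution \<theta>" and fin: "\<And>\<mu>. ereal_expectation \<theta> (max_utility \<mu>) < \<infinity>"
  shows "ereal_expectation \<theta> (max_utility (\<mu> + t *\<^sub>R (\<chi> i. 1)))
    = ereal_expectation \<theta> (max_utility \<mu>) + ereal t"
proof -
  interpret prob_space \<theta> using noise by (simp add: noise_distribution_def)
  have finite_case: "ereal_expectation \<theta> (max_utility (\<mu> + t *\<^sub>R (\<chi> i. 1)))
      = ereal_expectation \<theta> (max_utility \<mu>) + ereal t"
    if "ereal_expectation \<theta> (max_utility \<mu>) \<noteq> - \<infinity>" for \<mu> t
  proof -
    have "\<bar>ereal_expectation \<theta> (max_utility \<mu>)\<bar> \<noteq> \<infinity>"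
      using that fin[of \<mu>] by auto
    note * = integrable_of_ereal_expectation[OF _ this]
    have def: "ereal_expectation_defined \<theta> (max_utility \<mu>)"
      using noise by (simp add: noise_distribution_def)
    have "AE \<omega> in \<theta>. max_utility (\<mu> + t *\<^sub>R (\<chi> i. 1)) \<omega> = ereal (real_of_ereal (max_utility \<mu> \<omega>) + t)"
      using *(2)[OF def] by eventually_elim (metis max_utility_translate plus_ereal.simps(1))
    then have "ereal_expectation \<theta> (max_utility (\<mu> + t *\<^sub>R (\<chi> i. 1)))
        = ereal (expectation (\<lambda>\<omega>. real_of_ereal (max_utility \<mu> \<omega>) + t))"
      using *(1)[OF def] by (intro ereal_expectation_eq_integral) auto
    also have "\<dots> = ereal_expectation \<theta> (max_utility \<mu>) + ereal t"
      using *(1)[OF def] by (simp add: *(3)[OF def] prob_space)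
    finally show ?thesis .
  qed
  show ?thesis
  proof (cases "ereal_expectation \<theta> (max_utility \<mu>) = - \<infinity>")
    case True
    moreover have "ereal_expectation \<theta> (max_utility (\<mu> + t *\<^sub>R (\<chi> i. 1))) = - \<infinity>"
    proof (rule ccontr)
      assume *: "ereal_expectation \<theta> (max_utility (\<mu> + t *\<^sub>R (\<chi> i. 1))) \<noteq> - \<infinity>"
      from finite_case[OF this, of "- t"] True * show False
        by (cases "ereal_expectation \<theta> (max_utility (\<mu> + t *\<^sub>R (\<chi> i. 1)))") auto
    qed
    ultimately show ?thesis by simp
  qed (rule finite_case)
qed

lemma expected_max_all_minfty:
  assumes noise: "noise_distribution \<theta>" and fin: "\<And>\<mu>. ereal_expectation \<theta> (max_utility \<mu>) < \<infinity>"
    and "ereal_expectation \<theta> (max_utility \<mu>) = - \<infinity>"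
  shows "ereal_expectation \<theta> (max_utility \<nu>) = - \<infinity>"
proof -
  define t where "t = norm (\<nu> - \<mu>)"
  have "\<nu> $ i \<le> \<mu> $ i + t" for i
    using component_le_norm_cart[of "\<nu> - \<mu>" i] by (simp add: t_def)
  then have "\<nu> \<le> \<mu> + t *\<^sub>R (\<chi> i. 1)"
    by (simp add: less_eq_vec_def)
  then have "ereal_expectation \<theta> (max_utility \<nu>) \<le> ereal_expectation \<theta> (max_utility (\<mu> + t *\<^sub>R (\<chi> i. 1)))"
    by (intro ereal_expectation_mono max_utility_mono)
  also have "\<dots> = - \<infinity>"
    using assms by (simp add: expected_max_translate)
  finally show ?thesis by simp
qed

lemma expected_max_convex:
  fixes \<mu> \<nu> :: "real^'n"
  assumes noise: "noise_distribution \<theta>" and fin: "\<And>\<mu>::real^'n. ereal_expectation \<theta> (max_utility \<mu>) < \<infinity>"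
    and u: "0 < u" "u < 1"
  shows "ereal_expectation \<theta> (max_utility (u *\<^sub>R \<mu> + (1 - u) *\<^sub>R \<nu>))
    \<le> ereal u * ereal_expectation \<theta> (max_utility \<mu>) + ereal (1 - u) * ereal_expectation \<theta> (max_utility \<nu>)"
proof (cases "ereal_expectation \<theta> (max_utility 0) = - \<infinity>")
  case True
  then show ?thesis
    using expected_max_all_minfty[OF noise fin True] by simp
next
  case False
  define Y where "Y \<mu> \<omega> = real_of_ereal (max_utility \<mu> \<omega>)" for \<mu> :: "real^'n" and \<omega>
  have Y: "integrable \<theta> (Y \<mu>)" "AE \<omega> in \<theta>. max_utility \<mu> \<omega> = ereal (Y \<mu> \<omega>)"
    "ereal_expectation \<theta> (max_utility \<mu>) = ereal (integral\<^sup>L \<theta> (Y \<mu>))" for \<mu>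
  proof -
    have "ereal_expectation \<theta> (max_utility \<mu>) \<noteq> - \<infinity>"
      using expected_max_all_minfty[OF noise fin, of \<mu> 0] False by auto
    then have *: "\<bar>ereal_expectation \<theta> (max_utility \<mu>)\<bar> \<noteq> \<infinity>"
      using fin[of \<mu>] by auto
    have "ereal_expectation_defined \<theta> (max_utility \<mu>)"
      using noise by (simp add: noise_distribution_def)
    note integrable_of_ereal_expectation[OF this *]
    then show "integrable \<theta> (Y \<mu>)" "AE \<omega> in \<theta>. max_utility \<mu> \<omega> = ereal (Y \<mu> \<omega>)"
      "ereal_expectation \<theta> (max_utility \<mu>) = ereal (integral\<^sup>L \<theta> (Y \<mu>))"
      by (simp_all add: Y_def[abs_def])
  qed
  have "integral\<^sup>L \<theta> (Y (u *\<^sub>R \<mu> + (1 - u) *\<^sub>R \<nu>)) \<le> integral\<^sup>L \<theta> (\<lambda>\<omega>. u * Y \<mu> \<omega> + (1 - u) * Y \<nu> \<omega>)"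
  proof (rule integral_mono_AE)
    show "AE \<omega> in \<theta>. Y (u *\<^sub>R \<mu> + (1 - u) *\<^sub>R \<nu>) \<omega> \<le> u * Y \<mu> \<omega> + (1 - u) * Y \<nu> \<omega>"
      using Y(2)[of \<mu>] Y(2)[of \<nu>] Y(2)[of "u *\<^sub>R \<mu> + (1 - u) *\<^sub>R \<nu>"]
    proof eventually_elim
      case (elim \<omega>)
      then show ?case
        using max_utility_convex[OF u, of \<mu> \<nu> \<omega>] by simp
    qed
  qed (use Y(1) in auto)
  also have "\<dots> = u * integral\<^sup>L \<theta> (Y \<mu>) + (1 - u) * integral\<^sup>L \<theta> (Y \<nu>)"
    using Y(1) by simp
  finally show ?thesis by (simp add: Y(3))
qed

lemma robust_welfare_choice_welfare:
  assumes noise: "\<And>\<theta>. \<theta> \<in> \<Theta> \<Longrightarrow> noise_distribution \<theta>" and fin: "\<And>\<mu>. \<bar>robust_welfare \<Theta> \<mu>\<bar> \<noteq> \<infinity>"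
  shows "choice_welfare (robust_welfare \<Theta>)"
proof -
  have upper: "ereal_expectation \<theta> (max_utility \<mu>) \<le> robust_welfare \<Theta> \<mu>" if "\<theta> \<in> \<Theta>" for \<theta> \<mu>
    unfolding robust_welfare_def using that by (rule SUP_upper)
  have fin': "ereal_expectation \<theta> (max_utility \<mu>) < \<infinity>" if "\<theta> \<in> \<Theta>" for \<theta> \<mu>
    using upper[OF that, of \<mu>] fin[of \<mu>] by (auto simp: less_top[symmetric] top_ereal_def)
  have "mono (robust_welfare \<Theta>)"
    unfolding robust_welfare_def
    by (intro monoI SUP_mono') (auto intro!: ereal_expectation_mono max_utility_mono)
  moreover have "robust_welfare \<Theta> (\<mu> + t *\<^sub>R (\<chi> i. 1)) = robust_welfare \<Theta> \<mu> + ereal t" for \<mu> t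
  proof -
    have le: "robust_welfare \<Theta> (\<mu> + t *\<^sub>R (\<chi> i. 1)) \<le> robust_welfare \<Theta> \<mu> + ereal t" for \<mu> t
      unfolding robust_welfare_def[of _ "\<mu> + t *\<^sub>R (\<chi> i. 1)"]
    proof (rule SUP_least)
      fix \<theta>
      assume \<theta>: "\<theta> \<in> \<Theta>"
      show "ereal_expectation \<theta> (max_utility (\<mu> + t *\<^sub>R (\<chi> i. 1))) \<le> robust_welfare \<Theta> \<mu> + ereal t"
        unfolding expected_max_translate[OF noise[OF \<theta>] fin'[OF \<theta>]]
        by (rule add_right_mono[OF upper[OF \<theta>]])
    qed
    have "robust_welfare \<Theta> \<mu> \<le> robust_welfare \<Theta> (\<mu> + t *\<^sub>R (\<chi> i. 1)) + ereal (- t)"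
      using le[of "\<mu> + t *\<^sub>R (\<chi> i. 1)" "- t"] by simp
    then have "robust_welfare \<Theta> \<mu> + ereal t \<le> robust_welfare \<Theta> (\<mu> + t *\<^sub>R (\<chi> i. 1))"
      by (cases "robust_welfare \<Theta> \<mu>"; cases "robust_welfare \<Theta> (\<mu> + t *\<^sub>R (\<chi> i. 1))") auto
    with le show ?thesis by (rule antisym)
  qed
  moreover have "ereal_convex (robust_welfare \<Theta>)"
    unfolding ereal_convex_def
  proof (intro allI impI)
    fix x y :: "real^'a" and u :: real
    assume u: "0 \<le> u \<and> u \<le> 1"
    show "robust_welfare \<Theta> (u *\<^sub>R x + (1 - u) *\<^sub>R y)
      \<le> ereal u * robust_welfare \<Theta> x + ereal (1 - u) * robust_welfare \<Theta> y"
    proof (cases "u = 0 \<or> u = 1")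
      case True
      then show ?thesis by (auto simp: zero_ereal_def[symmetric])
    next
      case False
      with u have u: "0 < u" "u < 1" by auto
      show ?thesis
        unfolding robust_welfare_def[of _ "u *\<^sub>R x + (1 - u) *\<^sub>R y"]
      proof (rule SUP_least)
        fix \<theta>
        assume \<theta>: "\<theta> \<in> \<Theta>"
        have "ereal_expectation \<theta> (max_utility (u *\<^sub>R x + (1 - u) *\<^sub>R y))
            \<le> ereal u * ereal_expectation \<theta> (max_utility x)
              + ereal (1 - u) * ereal_expectation \<theta> (max_utility y)"
          by (rule expected_max_convex[OF noise[OF \<theta>] fin'[OF \<theta>] u])
        also have "\<dots> \<le> ereal u * robust_welfare \<Theta> x + ereal (1 - u) * robust_welfare \<Theta> y"
          using u \<theta> by (intro add_mono ereal_mult_left_mono upper) auto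
        finally show "ereal_expectation \<theta> (max_utility (u *\<^sub>R x + (1 - u) *\<^sub>R y))
            \<le> ereal u * robust_welfare \<Theta> x + ereal (1 - u) * robust_welfare \<Theta> y" .
      qed
    qed
  qed
  ultimately show ?thesis by (simp add: choice_welfare_def)
qed

section \<open>Noise distributions realizing an affine function\<close>

text \<open>With probability \<open>p $ i\<close> only alternative \<open>i\<close> is available, with noise \<open>c $ i\<close>; the other
  alternatives receive the value \<open>-\<infinity>\<close>.\<close>

definition single_alternative_noise :: "real^'n \<Rightarrow> real^'n \<Rightarrow> (ereal^'n) measure" where
  "single_alternative_noise p c = distr (measure_pmf (embed_pmf (\<lambda>i. p $ i))) borel
     (\<lambda>i. \<chi> j. if j = i then ereal (c $ j) else - \<infinity>)"

lemma borel_measurable_max_utility: "max_utility \<mu> \<in> borel_measurable borel"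
proof -
  have [measurable]: "(\<lambda>\<epsilon>::ereal^'a. \<epsilon> $ i) \<in> borel_measurable borel" for i
    by (intro borel_measurable_continuous_onI continuous_intros)
  show ?thesis
    unfolding max_utility_def by measurable
qed

lemma max_utility_single_alternative:
  "max_utility \<mu> (\<chi> j. if j = i then ereal (c $ j) else - \<infinity>) = ereal (\<mu> $ i + c $ i)"
  unfolding max_utility_def by (intro Max_eqI) auto

lemma single_alternative_noise:
  fixes p :: "real^'n"
  assumes p: "p \<in> prob_simplex"
  shows "noise_distribution (single_alternative_noise p c)"
    and "ereal_expectation (single_alternative_noise p c) (max_utility \<mu>) = ereal (p \<bullet> (\<mu> + c))"
proof -
  define P where "P = embed_pmf (\<lambda>i. p $ i)"
  define e :: "'n \<Rightarrow> ereal^'n" where "e i = (\<chi> j. if j = i then ereal (c $ j) else - \<infinity>)" for i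
  have \<theta>: "single_alternative_noise p c = distr (measure_pmf P) borel e"
    by (simp add: single_alternative_noise_def P_def e_def[abs_def])
  have pmf_P: "pmf P i = p $ i" for i
    unfolding P_def
  proof (rule pmf_embed_pmf)
    have "(\<integral>\<^sup>+ i. ennreal (p $ i) \<partial>count_space UNIV) = (\<Sum>i\<in>UNIV. ennreal (p $ i))"
      by (rule nn_integral_count_space_finite) simp
    then show "(\<integral>\<^sup>+ i. ennreal (p $ i) \<partial>count_space UNIV) = 1"
      using p by (subst (asm) sum_ennreal) (auto simp: prob_simplex_def)
  qed (use p in \<open>auto simp: prob_simplex_def\<close>)
  note [measurable] = borel_measurable_max_utility
  have e [measurable]: "e \<in> measure_pmf P \<rightarrow>\<^sub>M borel" by simp
  have max_e: "max_utility \<mu> (e i) = ereal (\<mu> $ i + c $ i)" for \<mu> i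
    unfolding e_def by (rule max_utility_single_alternative)
  have int: "integrable (distr (measure_pmf P) borel e) (\<lambda>\<epsilon>. real_of_ereal (max_utility \<mu> \<epsilon>))" for \<mu>
    by (subst integrable_distr_eq) (auto intro: integrable_measure_pmf_finite)
  have ae: "AE \<epsilon> in distr (measure_pmf P) borel e. max_utility \<mu> \<epsilon> = ereal (real_of_ereal (max_utility \<mu> \<epsilon>))" for \<mu>
    by (subst AE_distr_iff) (auto simp: max_e)
  show "noise_distribution (single_alternative_noise p c)"
    unfolding noise_distribution_def ereal_expectation_defined_def \<theta>
    using nn_integral_parts_of_integrable[OF int ae]
    by (auto intro: measure_pmf.prob_space_distr)
  have "ereal_expectation (single_alternative_noise p c) (max_utility \<mu>)
      = ereal (integral\<^sup>L (distr (measure_pmf P) borel e) (\<lambda>\<epsilon>. real_of_ereal (max_utility \<mu> \<epsilon>)))"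
    unfolding \<theta> by (rule ereal_expectation_eq_integral[OF int ae])
  also have "integral\<^sup>L (distr (measure_pmf P) borel e) (\<lambda>\<epsilon>. real_of_ereal (max_utility \<mu> \<epsilon>))
      = (\<Sum>i\<in>UNIV. (\<mu> $ i + c $ i) * p $ i)"
    by (subst integral_distr) (auto simp: max_e integral_measure_pmf_real[of UNIV] pmf_P)
  finally show "ereal_expectation (single_alternative_noise p c) (max_utility \<mu>) = ereal (p \<bullet> (\<mu> + c))"
    by (simp add: inner_vec_def mult.commute)
qed

text \<open>If alternative \<open>i\<close> has probability \<open>q \<nu> $ i\<close> and noise \<open>W \<nu> - \<nu> $ i\<close>, the expected
  maximum is \<open>q \<nu> \<bullet> (\<mu> - \<nu>) + W \<nu>\<close>, the tangent of \<open>W\<close> at \<open>\<nu>\<close>. A convex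
  function is the supremum of its tangents.\<close>

lemma robust_welfare_tangents:
  fixes W :: "real^'n \<Rightarrow> real"
  assumes W: "convex_on UNIV W" and g: "\<And>\<mu>. GDERIV W \<mu> :> q \<mu>" and q: "\<And>\<mu>. q \<mu> \<in> prob_simplex"
  shows "robust_welfare (range (\<lambda>\<nu>. single_alternative_noise (q \<nu>) (\<chi> i. W \<nu> - \<nu> $ i))) \<mu> = ereal (W \<mu>)"
proof -
  have "q \<nu> \<bullet> (\<mu> + (\<chi> i. W \<nu> - \<nu> $ i)) = W \<nu> + q \<nu> \<bullet> (\<mu> - \<nu>)" for \<nu>
  proof -
    have "\<mu> + (\<chi> i. W \<nu> - \<nu> $ i) = W \<nu> *\<^sub>R (\<chi> i. 1) + (\<mu> - \<nu>)"
      by (simp add: vec_eq_iff)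
    moreover have "q \<nu> \<bullet> (\<chi> i. 1) = 1"
      using q[of \<nu>] by (simp add: inner_vec_def prob_simplex_def)
    ultimately show ?thesis by (simp only: inner_add_right inner_scaleR_right)
  qed
  then have "ereal_expectation (single_alternative_noise (q \<nu>) (\<chi> i. W \<nu> - \<nu> $ i)) (max_utility \<mu>)
      = ereal (W \<nu> + q \<nu> \<bullet> (\<mu> - \<nu>))" for \<nu>
    by (simp only: single_alternative_noise(2)[OF q])
  then have "robust_welfare (range (\<lambda>\<nu>. single_alternative_noise (q \<nu>) (\<chi> i. W \<nu> - \<nu> $ i))) \<mu>
      = (SUP \<nu>. ereal (W \<nu> + q \<nu> \<bullet> (\<mu> - \<nu>)))"
    by (simp add: robust_welfare_def image_image)
  also have "\<dots> = ereal (W \<mu>)"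
  proof (rule antisym)
    show "(SUP \<nu>. ereal (W \<nu> + q \<nu> \<bullet> (\<mu> - \<nu>))) \<le> ereal (W \<mu>)"
      by (rule SUP_least) (simp add: convex_GDERIV_imp_above_tangent[OF W g])
    show "ereal (W \<mu>) \<le> (SUP \<nu>. ereal (W \<nu> + q \<nu> \<bullet> (\<mu> - \<nu>)))"
      by (rule SUP_upper2[of \<mu>]) auto
  qed
  finally show ?thesis .
qed

section \<open>The equivalence\<close>

lemma ereal_differentiable_ereal:
  assumes "\<And>\<mu>. GDERIV W \<mu> :> q \<mu>"
  shows "ereal_differentiable (\<lambda>x. ereal (W x))"
  using assms by (auto simp: ereal_differentiable_def gderiv_def differentiable_def)

lemma differentiable_choice_welfare_convex_on:
  assumes "differentiable_choice_welfare w"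
  shows "convex_on UNIV (\<lambda>x. real_of_ereal (w x))"
proof -
  have "\<bar>w x\<bar> \<noteq> \<infinity>" for x
    using assms by (simp add: differentiable_choice_welfare_def ereal_differentiable_def)
  then have "w = (\<lambda>x. ereal (real_of_ereal (w x)))"
    by (simp add: ereal_real)
  moreover have "ereal_convex w"
    using assms by (simp add: differentiable_choice_welfare_def choice_welfare_def)
  ultimately show ?thesis
    by (metis ereal_convex_ereal_iff)
qed

theorem theorem2:
  fixes q :: "real^'n \<Rightarrow> real^'n"
  assumes "choice_model q"
  shows
    "((\<exists>w :: real^'n \<Rightarrow> ereal. differentiable_choice_welfare w \<and>
         (\<forall>\<mu>. GDERIV (\<lambda>x. real_of_ereal (w x)) \<mu> :> q \<mu>))
      \<longleftrightarrow>
      (\<exists>V :: real^'n \<Rightarrow> ereal. essentially_strictly_convex V \<and> lower_semicontinuous V \<and>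
         (\<forall>x. x \<notin> prob_simplex \<longrightarrow> V x = \<infinity>) \<and>
         (\<forall>\<mu>. unique_arg_max (\<lambda>x. ereal (\<mu> \<bullet> x) - V x) prob_simplex (q \<mu>))))
     \<and>
     ((\<exists>V :: real^'n \<Rightarrow> ereal. essentially_strictly_convex V \<and> lower_semicontinuous V \<and>
         (\<forall>x. x \<notin> prob_simplex \<longrightarrow> V x = \<infinity>) \<and>
         (\<forall>\<mu>. unique_arg_max (\<lambda>x. ereal (\<mu> \<bullet> x) - V x) prob_simplex (q \<mu>)))
      \<longleftrightarrow>
      (\<exists>\<Theta> :: (ereal^'n) measure set. (\<forall>\<theta>\<in>\<Theta>. noise_distribution \<theta>) \<and>
         ereal_differentiable (robust_welfare \<Theta>) \<and>
         (\<forall>\<mu>. GDERIV (\<lambda>x. real_of_ereal (robust_welfare \<Theta> x)) \<mu> :> q \<mu>)))"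
  (is "(?welfare \<longleftrightarrow> ?regularized) \<and> (?regularized \<longleftrightarrow> ?robust)")
proof -
  have q: "q \<mu> \<in> prob_simplex" for \<mu>
    using assms by (auto simp: choice_model_def)
  have "?welfare \<Longrightarrow> ?regularized"
  proof (elim exE conjE)
    fix w :: "real^'n \<Rightarrow> ereal"
    assume "differentiable_choice_welfare w" "\<forall>\<mu>. GDERIV (\<lambda>x. real_of_ereal (w x)) \<mu> :> q \<mu>"
    then obtain W where W: "convex_on UNIV W" "\<And>\<mu>. GDERIV W \<mu> :> q \<mu>"
      using differentiable_choice_welfare_convex_on by blast
    note umax = unique_arg_max_simplex_conjugate[OF W q]
    have outside: "simplex_conjugate W x = \<infinity>" if "x \<notin> prob_simplex" for x
      using that by (simp add: simplex_conjugate_def)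
    have "proper (simplex_conjugate W)"
      unfolding proper_def
    proof (intro conjI exI allI)
      show "simplex_conjugate W (q 0) < \<infinity>" by (simp add: umax(2))
      show "- \<infinity> < simplex_conjugate W x" for x
        by (rule less_le_trans[OF _ simplex_conjugate_ge]) simp
    qed
    then have "essentially_strictly_convex (simplex_conjugate W)"
      using simplex_conjugate_convex outside umax(1)
      by (rule unique_arg_max_imp_essentially_strictly_convex)
    then show ?regularized
      using simplex_conjugate_lower_semicontinuous outside umax(1) by blast
  qed
  moreover have "?regularized \<Longrightarrow> ?welfare"
  proof (elim exE conjE)
    fix V :: "real^'n \<Rightarrow> ereal"
    assume V: "essentially_strictly_convex V" "lower_semicontinuous V"
      "\<forall>x. x \<notin> prob_simplex \<longrightarrow> V x = \<infinity>"
      "\<forall>\<mu>. unique_arg_max (\<lambda>x. ereal (\<mu> \<bullet> x) - V x) prob_simplex (q \<mu>)"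
    then have "proper V" by (simp add: essentially_strictly_convex_def)
    then obtain W where W: "\<And>\<mu> x. ereal (\<mu> \<bullet> x) - V x \<le> ereal (W \<mu>)"
        "\<And>\<mu>. ereal (\<mu> \<bullet> q \<mu>) - V (q \<mu>) = ereal (W \<mu>)"
        "convex_on UNIV W" "\<And>\<mu>. GDERIV W \<mu> :> q \<mu>"
      using regularized_value_properties[of V q] V by blast
    have "V (q \<mu>) = ereal (\<mu> \<bullet> q \<mu> - W \<mu>)" for \<mu>
      using W(2)[of \<mu>] by (cases "V (q \<mu>)") auto
    then have "choice_welfare (\<lambda>\<mu>. ereal (W \<mu>))"
      using W by (intro choice_welfare_of_simplex_sup[OF q])
    moreover have "ereal_differentiable (\<lambda>x. ereal (W x))"
      by (rule ereal_differentiable_ereal[OF W(4)])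
    ultimately show ?welfare
      using W(4) by (intro exI[of _ "\<lambda>x. ereal (W x)"]) (simp add: differentiable_choice_welfare_def)
  qed
  moreover have "?welfare \<Longrightarrow> ?robust"
  proof (elim exE conjE)
    fix w :: "real^'n \<Rightarrow> ereal"
    assume "differentiable_choice_welfare w" "\<forall>\<mu>. GDERIV (\<lambda>x. real_of_ereal (w x)) \<mu> :> q \<mu>"
    then obtain W where W: "convex_on UNIV W" "\<And>\<mu>. GDERIV W \<mu> :> q \<mu>"
      using differentiable_choice_welfare_convex_on by blast
    define \<Theta> where "\<Theta> = range (\<lambda>\<nu>. single_alternative_noise (q \<nu>) (\<chi> i. W \<nu> - \<nu> $ i))"
    have "robust_welfare \<Theta> = (\<lambda>\<mu>. ereal (W \<mu>))"
      unfolding \<Theta>_def using robust_welfare_tangents[OF W q] by (rule ext)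
    moreover have "\<forall>\<theta>\<in>\<Theta>. noise_distribution \<theta>"
      unfolding \<Theta>_def using single_alternative_noise(1)[OF q] by auto
    ultimately show ?robust
      using W(2) ereal_differentiable_ereal[OF W(2)] by (intro exI[of _ \<Theta>]) simp
  qed
  moreover have "?robust \<Longrightarrow> ?welfare"
  proof (elim exE conjE)
    fix \<Theta> :: "(ereal^'n) measure set"
    assume \<Theta>: "\<forall>\<theta>\<in>\<Theta>. noise_distribution \<theta>" "ereal_differentiable (robust_welfare \<Theta>)"
      "\<forall>\<mu>. GDERIV (\<lambda>x. real_of_ereal (robust_welfare \<Theta> x)) \<mu> :> q \<mu>"
    then have "choice_welfare (robust_welfare \<Theta>)"
      by (intro robust_welfare_choice_welfare) (auto simp: ereal_differentiable_def)
    with \<Theta> show ?welfare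
      by (intro exI[of _ "robust_welfare \<Theta>"]) (simp add: differentiable_choice_welfare_def)
  qed
  ultimately show ?thesis by blast
qed

end
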